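(* Let $A$ be an $A_\infty$-algebra over a field $\mathbb{K}$ and $m\ge2$. If $\mathbf{a}$ and $\mathbf{a}'\in\mathrm{Mat}^{(m+1)}_+(A)$ are two equivalent defining systems (of $\alpha_1,\dots,\alpha_m\in\mathrm{H}(A)$), then $[\mu(\mathbf{a}')]=[\mu(\mathbf{a})]\in\mathrm{H}(A)$.
   Context: $A_\infty$-algebra: a $\mathbb{Z}$- or $\mathbb{Z}_2$-graded $\mathbb{K}$-vector space $A$ with graded multilinear maps $b_n\colon A^{\otimes n}\to A$ ($n\ge1$) of degree $1$ such that for each $n\ge1$, $\sum_{r,t\ge0,\,s\ge1,\,r+s+t=n}b_{r+1+t}\circ(1^{\otimes r}\otimes b_s\otimes1^{\otimes t})=0$ (Koszul sign rule $(f\otimes g)(x\otimes y)=(-1)^{|g||x|}f(x)\otimes g(y)$). $\mathrm{H}(A)$ is the cohomology of $(A,b_1)$. A bar denotes $\bar a=(-1)^{|a|}a$ for homogeneous $a$, extended linearly and entrywise to matrices. $\mathrm{Mat}^{(m+1)}_+(A)$ is the space of strictly upper-triangular matrices $\mathbf{a}=(a_{ij})_{0\le i,j\le m}$ with entries in $A$. The product $\odot$ of matrices is $(\mathbf{a}\odot\mathbf{b})_{ij}=\sum_ka_{ik}\otimes b_{kj}$ (no signs); $b_n$ acts component-wise on matrices with entries in $A^{\otimes n}$. For $\mathbf{a}\in\mathrm{Mat}^{(m+1)}_+(A)$, $\partial_{\mathbf{a}}\mathbf{a}=\sum_{n\ge1}b_n(\underbrace{\mathbf{a}\odot\cdots\odot\mathbf{a}}_n)$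 (a finite sum), and $\mathbf{a}\approx\mathbf{a}'$ means $a_{ij}=a'_{ij}$ for all $(i,j)\ne(0,m)$. For $m\ge2$, $\mathbf{a}\in\mathrm{Mat}^{(m+1)}_+(A)$ is a defining system for $\alpha_1,\dots,\alpha_m\in\mathrm{H}(A)$ if $\partial_{\mathbf{a}}\mathbf{a}\approx0$ and each $\alpha_i$ is represented by the (then closed) element $a_{i-1,i}$. Put $\mu(\mathbf{a})=(\partial_{\mathbf{a}}\mathbf{a})_{0m}\in A$, which is $b_1$-closed. Two defining systems $\mathbf{a},\mathbf{a}'$ of $\alpha_1,\dots,\alpha_m$ are equivalent if there is $\mathbf{c}\in\mathrm{Mat}^{(m+1)}_+(A)$ such that $$\mathbf{a}'-\mathbf{a}\approx\sum_{r,t\ge0}b_{r+1+t}(\underbrace{\overline{\mathbf{a}'}\odot\cdots\odot\overline{\mathbf{a}'}}_r\odot\,\mathbf{c}\odot\underbrace{\mathbf{a}\odot\cdots\odot\mathbf{a}}_t).$$ *)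

theory Defs
  imports Complex_Main "HOL-Library.Multiset" "HOL-Library.Groups_Big_Fun"
begin

section \<open>Gradings\<close>

text \<open>
  A grading by \<open>\<int>\<close> and one by \<open>\<int>/2\<close> are treated together: the grading group is \<open>\<int>/N\<close> with
  \<open>N = 0\<close> or \<open>N = 2\<close>, its elements being represented by the residues mod \<open>N\<close> (recall that
  \<open>d mod 0 = d\<close>). As \<open>N\<close> is even, the parity of a degree is well defined.
\<close>

definition degrees :: "int \<Rightarrow> int set" where
  "degrees N = (if N = 0 then UNIV else {0..<N})"

definition is_decomposition :: "int \<Rightarrow> (int \<Rightarrow> 'a::ab_group_add set) \<Rightarrow> 'a \<Rightarrow> (int \<Rightarrow> 'a) \<Rightarrow> bool" where
  "is_decomposition N V x c \<longleftrightarrow>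
     (\<forall>d\<in>degrees N. c d \<in> V d) \<and> (\<forall>d. d \<notin> degrees N \<longrightarrow> c d = 0) \<and>
     finite {d. c d \<noteq> 0} \<and> x = Sum_any c"

locale graded_vector_space = vector_space scale
  for scale :: "'k::field \<Rightarrow> 'a::ab_group_add \<Rightarrow> 'a" +
  fixes N :: int and V :: "int \<Rightarrow> 'a set"
  assumes period: "N = 0 \<or> N = 2"
    and subspace_V: "d \<in> degrees N \<Longrightarrow> subspace (V d)"
    and direct_sum: "\<exists>!c. is_decomposition N V x c"

text \<open>\<open>signed d x\<close> is \<open>(-1)\<^sup>d x\<close>.\<close>

definition signed :: "int \<Rightarrow> 'a::ab_group_add \<Rightarrow> 'a" where
  "signed d x = (if even d then x else - x)"

definition bar :: "int \<Rightarrow> (int \<Rightarrow> 'a::ab_group_add set) \<Rightarrow> 'a \<Rightarrow> 'a" where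
  "bar N V x = Sum_any (\<lambda>d. signed d ((THE c. is_decomposition N V x c) d))"


section \<open>\<open>A\<^sub>\<infinity>\<close>-algebras\<close>

text \<open>
  A linear map \<open>b\<^sub>n\<close> on the \<open>n\<close>-th tensor power of \<open>A\<close> is a multilinear function of \<open>n\<close> arguments.
  All \<open>b\<^sub>n\<close> are combined into one function on lists, \<open>b\<^sub>n\<close> being its restriction to lists of
  length \<open>n\<close>; the value \<open>b []\<close> is irrelevant. In \<open>A_infinity\<close>, the triples \<open>(r, s, t)\<close> run over
  \<open>r + s + t = n\<close>, \<open>s \<ge> 1\<close>, and the sign is the one that the Koszul rule produces when \<open>b\<^sub>s\<close>, of
  degree 1, is moved past the first \<open>r\<close> arguments.
\<close>

definition homogeneous_list :: "int \<Rightarrow> (int \<Rightarrow> 'a set) \<Rightarrow> int list \<Rightarrow> 'a list \<Rightarrow> bool" where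
  "homogeneous_list N V ds xs \<longleftrightarrow> list_all2 (\<lambda>d x. d \<in> degrees N \<and> x \<in> V d) ds xs"

locale A_infinity_algebra = graded_vector_space scale N V
  for scale :: "'k::field \<Rightarrow> 'a::ab_group_add \<Rightarrow> 'a" and N :: int and V :: "int \<Rightarrow> 'a set" +
  fixes b :: "'a list \<Rightarrow> 'a"
  assumes multilinear: "Vector_Spaces.linear scale scale (\<lambda>x. b (xs @ [x] @ ys))"
    and degree_one: "xs \<noteq> [] \<Longrightarrow> homogeneous_list N V ds xs \<Longrightarrow> b xs \<in> V ((sum_list ds + 1) mod N)"
    and A_infinity: "xs \<noteq> [] \<Longrightarrow> homogeneous_list N V ds xs \<Longrightarrow>
      (\<Sum>(r, s, t) | r + s + t = length xs \<and> 1 \<le> s.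
         signed (sum_list (take r ds))
           (b (take r xs @ [b (take s (drop r xs))] @ drop (r + s) xs))) = 0"


section \<open>Cohomology of \<open>(A, b\<^sub>1)\<close>\<close>

definition cocycles :: "('a::ab_group_add list \<Rightarrow> 'a) \<Rightarrow> 'a set" where
  "cocycles b = {x. b [x] = 0}"

definition coboundaries :: "('a::ab_group_add list \<Rightarrow> 'a) \<Rightarrow> 'a set" where
  "coboundaries b = range (\<lambda>y. b [y])"

definition cohomologous :: "('a::ab_group_add list \<Rightarrow> 'a) \<Rightarrow> ('a \<times> 'a) set" where
  "cohomologous b = {(x, y). x \<in> cocycles b \<and> y \<in> cocycles b \<and> y - x \<in> coboundaries b}"

definition cohomology :: "('a::ab_group_add list \<Rightarrow> 'a) \<Rightarrow> 'a set set" where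
  "cohomology b = cocycles b // cohomologous b"

definition cohomology_class :: "('a::ab_group_add list \<Rightarrow> 'a) \<Rightarrow> 'a \<Rightarrow> 'a set" where
  "cohomology_class b x = cohomologous b `` {x}"


section \<open>Matrices\<close>

text \<open>
  Matrices have rows and columns indexed by \<open>0, \<dots>, m\<close>. An element of a tensor power of \<open>A\<close> is
  represented by a formal sum (a finite multiset) of pure tensors, the pure tensor
  \<open>x\<^sub>1 \<otimes> \<cdots> \<otimes> x\<^sub>n\<close> being the list \<open>[x\<^sub>1, \<dots>, x\<^sub>n]\<close>. No relations between formal sums are imposed; as
  \<open>b\<close> is multilinear, its additive extension does not depend on the representation.
\<close>

type_synonym 'a matrix = "nat \<Rightarrow> nat \<Rightarrow> 'a"
type_synonym 'a tensor = "'a list multiset"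

definition Mat_plus :: "nat \<Rightarrow> 'a::zero matrix set" where
  "Mat_plus m = {a. \<forall>i j. \<not> (i < j \<and> j \<le> m) \<longrightarrow> a i j = 0}"

definition matrix_approx :: "nat \<Rightarrow> 'a matrix \<Rightarrow> 'a matrix \<Rightarrow> bool" where
  "matrix_approx m a a' \<longleftrightarrow> (\<forall>i\<le>m. \<forall>j\<le>m. (i, j) \<noteq> (0, m) \<longrightarrow> a i j = a' i j)"

definition tensor_mult :: "'a tensor \<Rightarrow> 'a tensor \<Rightarrow> 'a tensor" where
  "tensor_mult X Y = (\<Sum>xs\<in>#X. image_mset (\<lambda>ys. xs @ ys) Y)"

definition odot :: "nat \<Rightarrow> 'a tensor matrix \<Rightarrow> 'a tensor matrix \<Rightarrow> 'a tensor matrix" where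
  "odot m P Q = (\<lambda>i j. \<Sum>k\<le>m. tensor_mult (P i k) (Q k j))"

definition odot_unit :: "'a tensor matrix" where
  "odot_unit = (\<lambda>i j. if i = j then {#[]#} else {#})"

definition odot_list :: "nat \<Rightarrow> 'a matrix list \<Rightarrow> 'a tensor matrix" where
  "odot_list m Ms = foldr (\<lambda>M. odot m (\<lambda>i j. {#[M i j]#})) Ms odot_unit"

definition apply_entries :: "('a::ab_group_add list \<Rightarrow> 'a) \<Rightarrow> 'a tensor matrix \<Rightarrow> 'a matrix" where
  "apply_entries b P = (\<lambda>i j. \<Sum>xs\<in>#P i j. b xs)"

text \<open>
  The sums over all \<open>n \<ge> 1\<close> and all \<open>r, t \<ge> 0\<close> below are finite for strictly upper-triangular
  matrices; \<open>Sum_any\<close> is the sum of a finitely supported family.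
\<close>

definition deformed_del :: "nat \<Rightarrow> ('a::ab_group_add list \<Rightarrow> 'a) \<Rightarrow> 'a matrix \<Rightarrow> 'a matrix" where
  "deformed_del m b a = (\<lambda>i j.
     Sum_any (\<lambda>n. if 1 \<le> n then apply_entries b (odot_list m (replicate n a)) i j else 0))"


section \<open>Defining systems\<close>

definition defining_system ::
    "nat \<Rightarrow> ('a::ab_group_add list \<Rightarrow> 'a) \<Rightarrow> (nat \<Rightarrow> 'a set) \<Rightarrow> 'a matrix \<Rightarrow> bool" where
  "defining_system m b \<alpha> a \<longleftrightarrow>
     a \<in> Mat_plus m \<and> matrix_approx m (deformed_del m b a) (\<lambda>i j. 0) \<and>
     (\<forall>i\<in>{1..m}. a (i - 1) i \<in> \<alpha> i)"

definition massey_cocycle :: "nat \<Rightarrow> ('a::ab_group_add list \<Rightarrow> 'a) \<Rightarrow> 'a matrix \<Rightarrow> 'a" where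
  "massey_cocycle m b a = deformed_del m b a 0 m"

text \<open>\<open>equivalent_systems m b N V a a'\<close>: the order of \<open>a\<close>, \<open>a'\<close> matters, as symmetry is not built in.\<close>

definition equivalent_systems ::
    "nat \<Rightarrow> ('a::ab_group_add list \<Rightarrow> 'a) \<Rightarrow> int \<Rightarrow> (int \<Rightarrow> 'a set) \<Rightarrow> 'a matrix \<Rightarrow> 'a matrix \<Rightarrow> bool" where
  "equivalent_systems m b N V a a' \<longleftrightarrow>
     (\<exists>c\<in>Mat_plus m.
        matrix_approx m (\<lambda>i j. a' i j - a i j)
          (\<lambda>i j. Sum_any (\<lambda>(r, t).
             apply_entries b
               (odot_list m (replicate r (\<lambda>i j. bar N V (a' i j)) @ [c] @ replicate t a)) i j)))"

end

theory Submission
  imports Defs "HOL-Library.Function_Algebras"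
begin

text \<open>
  Write \<open>D x = \<Sum>\<^sub>n b(x\<^sup>n)\<close> for a matrix \<open>x\<close>, where \<open>x\<^sup>n\<close> is the word of \<open>n\<close> letters \<open>x\<close> and \<open>b\<close> acts on
  words of matrices, with values in matrices. Matrices over an \<open>A\<^sub>\<infinity>\<close>-algebra form an \<open>A\<^sub>\<infinity>\<close>-algebra
  themselves, in which the Koszul sign of moving \<open>b\<close> past a letter is the entrywise bar. Apply its
  \<open>A\<^sub>\<infinity>\<close>-relation to the words \<open>bar a'\<^sup>r c a\<^sup>t\<close> and sum over all \<open>r\<close> and \<open>t\<close>. The inner operation is
  applied to letters before \<open>c\<close>, to a block around \<open>c\<close>, or to letters after \<open>c\<close>, so that, with
  \<open>H = \<Sum> b(bar a'\<^sup>r c a\<^sup>t)\<close>,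
      \<open>\<Sum> b(a'\<^sup>p, D(bar a'), bar a'\<^sup>u, c, a\<^sup>t) + \<Sum> b(a'\<^sup>p, H, a\<^sup>q)
     + \<Sum> b(a'\<^sup>r, bar c, bar a\<^sup>u, D a, a\<^sup>q) = 0.\<close>
  For defining systems, \<open>D a\<close> and \<open>D(bar a') = - bar(D a')\<close> vanish outside the corner \<open>(0, m)\<close>. A
  word that contains such a letter and another, strictly upper-triangular, letter has value 0:
  the first and the third sum vanish. Equivalence says that \<open>H = a' - a - e\<close> with \<open>e\<close> supported in
  the corner, so that the second sum is \<open>\<Sum> b(a'\<^sup>p, a' - a, a\<^sup>q) - b(e)\<close>, and here the sum
  telescopes to \<open>D a' - D a\<close>. Hence \<open>D a' - D a = b(e)\<close>, and the corner entry of this equation says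
  that the two Massey cocycles differ by a coboundary (\<open>curvature_difference\<close>). The relation for the
  words \<open>a\<^sup>n\<close> shows in the same way that they are cocycles (\<open>curvature_closed\<close>).

  These computations use only formal properties, which the locales \<open>involutive_A_infinity\<close> and
  \<open>filtered_A_infinity\<close> collect: an involution in place of homogeneous elements and degrees, and a
  filtration, namely by the distance from the diagonal, in place of matrix entries. What remains
  is to show that an \<open>A\<^sub>\<infinity>\<close>-algebra satisfies the first set of axioms
  (\<open>involutive_A_infinity_b0\<close>), and that matrices inherit it and satisfy the second
  (\<open>filtered_A_infinity_matrix\<close>).
\<close>

section \<open>Sums over compositions\<close>

lemma sum_atMost_add_Suc:
  fixes h :: "nat \<Rightarrow> 'a::comm_monoid_add"
  shows "(\<Sum>p\<le>r + Suc t. h p) = (\<Sum>p\<le>r. h p) + (\<Sum>u\<le>t. h (Suc (r + u)))"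
  by (induction t) (simp_all add: add.assoc)

text \<open>
  A Cauchy product of families that vanish in total degree above \<open>m\<close> can be summed over a square.
  Sums over the words of bounded length thereby become sums over independent exponents, inside
  which \<open>b\<close> can be pulled out by multilinearity.
\<close>

lemma sum_antidiagonals_eq_square:
  fixes g :: "nat \<Rightarrow> nat \<Rightarrow> 'a::comm_monoid_add"
  assumes "\<And>p q. m < p + q \<Longrightarrow> g p q = 0"
  shows "(\<Sum>n\<le>m. \<Sum>p\<le>n. g p (n - p)) = (\<Sum>p\<le>m. \<Sum>q\<le>m. g p q)"
proof -
  have "(\<Sum>n\<le>m. \<Sum>p\<le>n. g p (n - p)) = (\<Sum>(p, q) | p + q \<le> m. g p q)"
    using sum.triangle_reindex_eq[of "\<lambda>p q. g p q" m] by simp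
  also have "\<dots> = (\<Sum>(p, q)\<in>{..m} \<times> {..m}. g p q)"
    by (rule sum.mono_neutral_left) (auto simp: not_le[symmetric] intro: assms)
  also have "\<dots> = (\<Sum>p\<le>m. \<Sum>q\<le>m. g p q)"
    by (simp add: sum.cartesian_product)
  finally show ?thesis .
qed

lemma sum_compositions_eq_cube:
  fixes g :: "nat \<Rightarrow> nat \<Rightarrow> nat \<Rightarrow> 'a::comm_monoid_add"
  assumes "\<And>p s q. m < p + s + q \<Longrightarrow> g p s q = 0"
  shows "(\<Sum>n\<le>m. \<Sum>p\<le>n. \<Sum>s\<le>n - p. g p s (n - p - s)) = (\<Sum>p\<le>m. \<Sum>s\<le>m. \<Sum>q\<le>m. g p s q)"
proof -
  have "(\<Sum>n\<le>m. \<Sum>p\<le>n. \<Sum>s\<le>n - p. g p s (n - p - s))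
      = (\<Sum>p\<le>m. \<Sum>v\<le>m. \<Sum>s\<le>v. g p s (v - s))"
    by (rule sum_antidiagonals_eq_square) (auto intro!: sum.neutral assms)
  also have "\<dots> = (\<Sum>p\<le>m. \<Sum>s\<le>m. \<Sum>q\<le>m. g p s q)"
    by (intro sum.cong refl sum_antidiagonals_eq_square) (auto intro!: assms)
  finally show ?thesis .
qed

section \<open>Multiadditive functions of lists\<close>

definition multiadditive :: "('a::ab_group_add list \<Rightarrow> 'b::ab_group_add) \<Rightarrow> bool" where
  "multiadditive f \<longleftrightarrow> (\<forall>us x y vs. f (us @ [x + y] @ vs) = f (us @ [x] @ vs) + f (us @ [y] @ vs))"

lemma multiadditiveD:
  "multiadditive f \<Longrightarrow> f (us @ (x + y) # vs) = f (us @ x # vs) + f (us @ y # vs)"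
  by (simp add: multiadditive_def)

lemma multiadditive_zero: "multiadditive f \<Longrightarrow> f (us @ 0 # vs) = 0"
  using multiadditiveD[of f us 0 0 vs] by simp

lemma multiadditive_minus: "multiadditive f \<Longrightarrow> f (us @ - x # vs) = - f (us @ x # vs)"
  using multiadditiveD[of f us x "- x" vs] multiadditive_zero[of f us vs]
  by (simp add: eq_neg_iff_add_eq_0 add.commute)

lemma multiadditive_diff:
  "multiadditive f \<Longrightarrow> f (us @ (x - y) # vs) = f (us @ x # vs) - f (us @ y # vs)"
  using multiadditiveD[of f us x "- y" vs] by (simp add: multiadditive_minus)

lemma multiadditive_sum:
  "multiadditive f \<Longrightarrow> f (us @ (\<Sum>k\<in>K. g k) # vs) = (\<Sum>k\<in>K. f (us @ g k # vs))"
  by (induction K rule: infinite_finite_induct) (simp_all add: multiadditive_zero multiadditiveD)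

lemma multiadditive_sum_mset:
  "multiadditive f \<Longrightarrow> f (us @ (\<Sum>k\<in>#K. g k) # vs) = (\<Sum>k\<in>#K. f (us @ g k # vs))"
  by (induction K) (simp_all add: multiadditive_zero multiadditiveD)

lemma multiadditive_signed:
  "multiadditive f \<Longrightarrow> f (us @ signed d x # vs) = signed d (f (us @ x # vs))"
  by (simp add: signed_def multiadditive_minus)

section \<open>\<open>A\<^sub>\<infinity>\<close>-structures without homogeneity\<close>

text \<open>
  The summand of the \<open>A\<^sub>\<infinity>\<close>-relation in which the inner operation takes the letters
  \<open>r + 1, \<dots>, r + s\<close>; the Koszul sign is carried by the bars on the letters before them.
\<close>

definition insertion :: "('a list \<Rightarrow> 'a) \<Rightarrow> ('a \<Rightarrow> 'a) \<Rightarrow> nat \<Rightarrow> nat \<Rightarrow> 'a list \<Rightarrow> 'a" where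
  "insertion b \<beta> r s xs = b (map \<beta> (take r xs) @ b (take s (drop r xs)) # drop (r + s) xs)"

text \<open>
  Defining systems need not have homogeneous entries. With the map \<open>\<beta> x = (-1)\<^bsup>|x|\<^esup> x\<close> in place of
  degrees, the axioms make sense for all elements and are stable under passage to matrices; that
  \<open>b\<close> has degree 1 becomes \<open>bar_b\<close>. The normalisation \<open>b [] = 0\<close> makes the summands with \<open>s = 0\<close>
  vanish, so that all summation ranges can start at 0.
\<close>

locale involutive_A_infinity =
  fixes b :: "'a::ab_group_add list \<Rightarrow> 'a" and \<beta> :: "'a \<Rightarrow> 'a"
  assumes b_Nil: "b [] = 0"
    and b_multiadditive: "multiadditive b"
    and bar_bar: "\<beta> (\<beta> x) = x"
    and bar_add: "\<beta> (x + y) = \<beta> x + \<beta> y"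
    and bar_b: "\<beta> (b xs) = - b (map \<beta> xs)"
    and relation: "(\<Sum>r\<le>length xs. \<Sum>s\<le>length xs - r. insertion b \<beta> r s xs) = 0"
begin

lemma bar_zero: "\<beta> 0 = 0"
  using bar_add[of 0 0] by simp

lemma bar_sum: "\<beta> (\<Sum>k\<in>K. g k) = (\<Sum>k\<in>K. \<beta> (g k))"
  by (induction K rule: infinite_finite_induct) (simp_all add: bar_zero bar_add)

lemma bar_sum_mset: "\<beta> (\<Sum>k\<in>#K. g k) = (\<Sum>k\<in>#K. \<beta> (g k))"
  by (induction K) (simp_all add: bar_zero bar_add)

lemma relation_powers:
  "(\<Sum>r\<le>n. \<Sum>s\<le>n - r. b (replicate r (\<beta> a) @ b (replicate s a) # replicate (n - r - s) a)) = 0"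
proof -
  have "insertion b \<beta> r s (replicate n a)
      = b (replicate r (\<beta> a) @ b (replicate s a) # replicate (n - r - s) a)"
    if "r \<le> n" "s \<le> n - r" for r s
    using that by (simp add: insertion_def min_def)
  then have "(\<Sum>r\<le>n. \<Sum>s\<le>n - r. b (replicate r (\<beta> a) @ b (replicate s a) # replicate (n - r - s) a))
      = (\<Sum>r\<le>n. \<Sum>s\<le>n - r. insertion b \<beta> r s (replicate n a))"
    by (intro sum.cong refl) simp
  also have "\<dots> = 0"
    using relation[of "replicate n a"] by simp
  finally show ?thesis .
qed

text \<open>
  The three sums collect the positions of the inner operation: before \<open>c\<close>, around \<open>c\<close>, after \<open>c\<close>.
  A letter \<open>\<beta> a'\<close> in front of it is barred once more and becomes \<open>a'\<close>.
\<close>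

lemma relation_two_powers:
  "(\<Sum>p\<le>r. \<Sum>s\<le>r - p. b (replicate p a' @ b (replicate s (\<beta> a')) #
        replicate (r - p - s) (\<beta> a') @ c # replicate t a))
   + (\<Sum>p\<le>r. \<Sum>u\<le>t. b (replicate p a' @
        b (replicate (r - p) (\<beta> a') @ c # replicate u a) # replicate (t - u) a))
   + (\<Sum>p\<le>t. \<Sum>s\<le>t - p. b (replicate r a' @ \<beta> c #
        replicate p (\<beta> a) @ b (replicate s a) # replicate (t - p - s) a)) = 0"
  (is "?L + ?M + ?R = 0")
proof -
  let ?w = "replicate r (\<beta> a') @ c # replicate t a"
  let ?f = "\<lambda>p s. insertion b \<beta> p s ?w"
  have bars: "\<beta> \<circ> \<beta> = id" by (auto simp: bar_bar)
  have left: "?f p s = b (replicate p a' @ b (replicate s (\<beta> a')) #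
        replicate (r - p - s) (\<beta> a') @ c # replicate t a)" if "p \<le> r" "s \<le> r - p" for p s
    using that by (simp add: insertion_def min_def bar_bar)
  have middle: "?f p (Suc (r - p + u)) = b (replicate p a' @
        b (replicate (r - p) (\<beta> a') @ c # replicate u a) # replicate (t - u) a)"
    if "p \<le> r" "u \<le> t" for p u
  proof -
    obtain r' where "r = p + r'" using \<open>p \<le> r\<close> le_Suc_ex by blast
    then show ?thesis
      using that by (simp add: insertion_def bar_bar min_def)
  qed
  have right: "?f (Suc (r + p)) s = b (replicate r a' @ \<beta> c #
        replicate p (\<beta> a) @ b (replicate s a) # replicate (t - p - s) a)"
    if "p \<le> t" "s \<le> t - p" for p s
    using that by (simp add: insertion_def min_def bar_bar Suc_diff_le)
  \<comment> \<open>For \<open>p \<le> r\<close> the block stays before \<open>c\<close> if \<open>s \<le> r - p\<close>; else it ends \<open>u\<close> letters after \<open>c\<close>.\<close>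
  have split_s: "(\<Sum>s\<le>r + Suc t - p. ?f p s)
      = (\<Sum>s\<le>r - p. ?f p s) + (\<Sum>u\<le>t. ?f p (Suc (r - p + u)))" if "p \<le> r" for p
  proof -
    have "r + Suc t - p = r - p + Suc t" using that by simp
    then show ?thesis by (simp only: sum_atMost_add_Suc)
  qed
  have "(\<Sum>p\<le>r + Suc t. \<Sum>s\<le>r + Suc t - p. ?f p s)
      = (\<Sum>p\<le>r. \<Sum>s\<le>r + Suc t - p. ?f p s) + (\<Sum>p\<le>t. \<Sum>s\<le>t - p. ?f (Suc (r + p)) s)"
    unfolding sum_atMost_add_Suc by simp
  also have "(\<Sum>p\<le>r. \<Sum>s\<le>r + Suc t - p. ?f p s)
      = (\<Sum>p\<le>r. (\<Sum>s\<le>r - p. ?f p s) + (\<Sum>u\<le>t. ?f p (Suc (r - p + u))))"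
    by (intro sum.cong refl split_s) simp
  also have "\<dots> = ?L + ?M"
    unfolding sum.distrib by (intro arg_cong2[of _ _ _ _ "(+)"] sum.cong refl left middle) auto
  also have "(\<Sum>p\<le>t. \<Sum>s\<le>t - p. ?f (Suc (r + p)) s) = ?R"
    by (intro sum.cong refl right) auto
  finally show ?thesis
    using relation[of ?w] by simp
qed

end

text \<open>
  The model is \<open>F k\<close>, the matrices supported on the entries \<open>(i, j)\<close> with \<open>j - i \<ge> k\<close>: \<open>F 1\<close> are the
  strictly upper-triangular matrices, \<open>F m\<close> those supported in the corner \<open>(0, m)\<close>, and \<open>F (m + 1)\<close>
  is zero. A value of \<open>b\<close> thus vanishes as soon as the degrees of its arguments add up to more
  than \<open>m\<close>.
\<close>

locale filtered_A_infinity = involutive_A_infinity b \<beta>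
  for b :: "'a::ab_group_add list \<Rightarrow> 'a" and \<beta> :: "'a \<Rightarrow> 'a" +
  fixes F :: "nat \<Rightarrow> 'a set" and m :: nat
  assumes b_filtered: "xs \<noteq> [] \<Longrightarrow> list_all2 (\<lambda>x k. x \<in> F k) xs ks \<Longrightarrow> b xs \<in> F (sum_list ks)"
    and bar_filtered: "x \<in> F k \<Longrightarrow> \<beta> x \<in> F k"
    and filtration_vanishes: "m < k \<Longrightarrow> x \<in> F k \<Longrightarrow> x = 0"
begin

text \<open>This is \<open>\<partial>\<^sub>a a\<close>; for \<open>a \<in> F 1\<close>, the summands with \<open>n > m\<close> would vanish.\<close>

definition curvature :: "'a \<Rightarrow> 'a" where
  "curvature a = (\<Sum>n\<le>m. b (replicate n a))"

text \<open>The right-hand side of the equation that defines equivalence of \<open>a\<close> and \<open>a'\<close> by means of \<open>c\<close>.\<close>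

definition homotopy :: "'a \<Rightarrow> 'a \<Rightarrow> 'a \<Rightarrow> 'a" where
  "homotopy a' c a = (\<Sum>r\<le>m. \<Sum>t\<le>m. b (replicate r (\<beta> a') @ c # replicate t a))"

lemma filtered_replicate: "x \<in> F k \<Longrightarrow> list_all2 (\<lambda>x k. x \<in> F k) (replicate n x) (replicate n k)"
  by (simp add: list_all2_conv_all_nth)

lemma b_filtered_vanishes:
  "list_all2 (\<lambda>x k. x \<in> F k) xs ks \<Longrightarrow> m < sum_list ks \<Longrightarrow> b xs = 0"
  using b_filtered[of xs ks] filtration_vanishes[of "sum_list ks" "b xs"]
  by (cases "xs = []") (auto simp: b_Nil)

lemma curvature_bar: "curvature (\<beta> a) = - \<beta> (curvature a)"
  by (simp add: curvature_def bar_sum bar_b sum_negf)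

lemma b_powers_vanish:
  assumes "a \<in> F 1" "m < n"
  shows "b (replicate n a) = 0"
  using filtered_replicate[OF assms(1), of n] assms(2)
  by (intro b_filtered_vanishes[of _ "replicate n 1"]) (auto simp: sum_list_replicate)

lemma b_insertion_vanishes:
  assumes "x \<in> F 1" "y \<in> F 1" "z \<in> F k" "m < p + k + q"
  shows "b (replicate p x @ z # replicate q y) = 0"
  using filtered_replicate[OF assms(1), of p] filtered_replicate[OF assms(2), of q] assms(3,4)
  by (intro b_filtered_vanishes[of _ "replicate p 1 @ k # replicate q 1"])
     (auto simp: sum_list_replicate intro!: list_all2_appendI)

lemma b_double_insertion_vanishes:
  assumes "x \<in> F 1" "y \<in> F 1" "y' \<in> F 1" "z \<in> F k" "z' \<in> F k'" "m < p + k + q + k' + q'"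
  shows "b (replicate p x @ z # replicate q y @ z' # replicate q' y') = 0"
  using filtered_replicate[OF assms(1), of p] filtered_replicate[OF assms(2), of q]
    filtered_replicate[OF assms(3), of q'] assms(4-6)
  by (intro b_filtered_vanishes[of _ "replicate p 1 @ k # replicate q 1 @ k' # replicate q' 1"])
     (auto simp: sum_list_replicate intro!: list_all2_appendI)

lemma b_power_filtered: "a \<in> F 1 \<Longrightarrow> 0 < n \<Longrightarrow> b (replicate n a) \<in> F n"
  using b_filtered[of "replicate n a" "replicate n 1"] filtered_replicate[of a 1 n]
  by (simp add: sum_list_replicate)

text \<open>
An element of \<open>F m\<close> leaves no room for a second argument: only \<open>p = q = 0\<close> contributes.
\<close>

lemma b_corner:
  assumes "x \<in> F 1" "y \<in> F 1" "z \<in> F m"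
  shows "(\<Sum>p\<le>m. \<Sum>q\<le>m. b (replicate p x @ z # replicate q y)) = b [z]"
proof -
  have "b (replicate p x @ z # replicate q y) = (if q = 0 then if p = 0 then b [z] else 0 else 0)" for p q
    using b_insertion_vanishes[OF assms, of p q] by auto
  then show ?thesis by simp
qed

text \<open>
  The relations for the words \<open>a\<^sup>n\<close> add up to \<open>\<Sum> b(bar a\<^sup>p, D a, a\<^sup>q) = 0\<close> for the curvature \<open>D a\<close>, and
  all summands but \<open>b(D a)\<close> vanish for reasons of filtration.
\<close>

lemma curvature_closed:
  assumes a: "a \<in> F 1" and D: "curvature a \<in> F m"
  shows "b [curvature a] = 0"
proof -
  let ?g = "\<lambda>p s q. b (replicate p (\<beta> a) @ b (replicate s a) # replicate q a)"
  have vanish: "?g p s q = 0" if "m < p + s + q" for p s q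
  proof (cases "s = 0")
    case True
    then show ?thesis by (simp add: b_Nil multiadditive_zero[OF b_multiadditive])
  next
    case False
    then show ?thesis
      using that b_insertion_vanishes[OF bar_filtered[OF a] a b_power_filtered[OF a]] by simp
  qed
  have "0 = (\<Sum>n\<le>m. \<Sum>p\<le>n. \<Sum>s\<le>n - p. ?g p s (n - p - s))"
    by (simp only: relation_powers sum.neutral_const)
  also have "\<dots> = (\<Sum>p\<le>m. \<Sum>s\<le>m. \<Sum>q\<le>m. ?g p s q)"
    by (intro sum_compositions_eq_cube vanish)
  also have "\<dots> = (\<Sum>p\<le>m. \<Sum>q\<le>m. \<Sum>s\<le>m. ?g p s q)"
    by (intro sum.cong refl sum.swap)
  also have "\<dots> = (\<Sum>p\<le>m. \<Sum>q\<le>m. b (replicate p (\<beta> a) @ curvature a # replicate q a))"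
    by (simp add: curvature_def multiadditive_sum[OF b_multiadditive])
  also have "\<dots> = b [curvature a]"
    using b_corner[OF bar_filtered[OF a] a D] .
  finally show ?thesis by simp
qed

text \<open>
  By linearity the summand is \<open>G(p + 1, q) - G(p, q + 1)\<close> for \<open>G(p, q) = b(a'\<^sup>p, a\<^sup>q)\<close>. Summation
  over the square leaves only its boundary, half of which lies in total degree above \<open>m\<close>, where \<open>G\<close>
  is zero; the other half consists of the powers of \<open>a'\<close> and of \<open>a\<close>.
\<close>

lemma telescope:
  assumes "a \<in> F 1" "a' \<in> F 1"
  shows "(\<Sum>p\<le>m. \<Sum>q\<le>m. b (replicate p a' @ (a' - a) # replicate q a))
    = curvature a' - curvature a"
proof -
  define G where "G p q = b (replicate p a' @ replicate q a)" for p q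
  have step: "b (replicate p a' @ (a' - a) # replicate q a) = G (Suc p) q - G p (Suc q)" for p q
    by (simp add: G_def multiadditive_diff[OF b_multiadditive] replicate_append_same[symmetric])
  have shift: "(\<Sum>p\<le>m. h (Suc p)) = (\<Sum>p\<le>m. h p) - h 0" if "h (Suc m) = 0" for h :: "nat \<Rightarrow> 'a"
    using sum.atMost_Suc[of h m] sum.atMost_Suc_shift[of h m] that by (simp add: algebra_simps)
  have vanish: "G p q = 0" if "m < p + q" for p q
    unfolding G_def
  proof (rule b_filtered_vanishes[of _ "replicate p 1 @ replicate q 1"])
    show "list_all2 (\<lambda>x k. x \<in> F k) (replicate p a' @ replicate q a) (replicate p 1 @ replicate q 1)"
      by (intro list_all2_appendI filtered_replicate assms)
  qed (use that in \<open>simp add: sum_list_replicate\<close>)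
  have "(\<Sum>p\<le>m. \<Sum>q\<le>m. b (replicate p a' @ (a' - a) # replicate q a))
      = (\<Sum>q\<le>m. \<Sum>p\<le>m. G (Suc p) q) - (\<Sum>p\<le>m. \<Sum>q\<le>m. G p (Suc q))"
    unfolding step sum_subtractf by (subst sum.swap) (rule refl)
  also have "\<dots> = ((\<Sum>q\<le>m. \<Sum>p\<le>m. G p q) - (\<Sum>q\<le>m. G 0 q)) - ((\<Sum>p\<le>m. \<Sum>q\<le>m. G p q) - (\<Sum>p\<le>m. G p 0))"
    by (simp add: shift[of "\<lambda>p. G p _"] shift[of "G _"] vanish sum_subtractf)
  also have "(\<Sum>q\<le>m. \<Sum>p\<le>m. G p q) = (\<Sum>p\<le>m. \<Sum>q\<le>m. G p q)"
    by (rule sum.swap)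
  finally show ?thesis
    by (simp add: curvature_def G_def)
qed

lemma curvature_vanishes_in_product:
  assumes "x \<in> F 1" "y \<in> F 1" "y' \<in> F 1" "c \<in> F 1" "z \<in> F m"
  shows "b (replicate p x @ z # replicate u y @ c # replicate q y') = 0"
    and "b (replicate p x @ c # replicate u y @ z # replicate q y') = 0"
  by (rule b_double_insertion_vanishes[OF assms(1-3)], rule assms, rule assms, simp)+

text \<open>
  The relations for all words \<open>bar a'\<^sup>r c a\<^sup>t\<close> with \<open>r, t \<le> m\<close> are added up. The three parts of
  \<open>relation_two_powers\<close> are rearranged so that the inner operation is summed over all exponents first:
  it then yields the curvature of \<open>bar a'\<close>, the homotopy, and the curvature of \<open>a\<close>.
\<close>

lemma curvature_difference:
  assumes a: "a \<in> F 1" and a': "a' \<in> F 1" and c: "c \<in> F 1"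
    and D: "curvature a \<in> F m" and D': "curvature a' \<in> F m"
    and e: "a' - a - homotopy a' c a \<in> F m"
  shows "curvature a' - curvature a = b [a' - a - homotopy a' c a]"
proof -
  note ba' = bar_filtered[OF a'] and ba = bar_filtered[OF a] and bc = bar_filtered[OF c]
  note lin_zero = multiadditive_zero[OF b_multiadditive]
  note lin_sum = multiadditive_sum[OF b_multiadditive]
  let ?l = "\<lambda>t p s u. b (replicate p a' @ b (replicate s (\<beta> a')) # replicate u (\<beta> a') @ c # replicate t a)"
  let ?w = "\<lambda>r t. b (replicate r (\<beta> a') @ c # replicate t a)"
  let ?m = "\<lambda>p r t q. b (replicate p a' @ ?w r t # replicate q a)"
  let ?r = "\<lambda>r p s q. b (replicate r a' @ \<beta> c # replicate p (\<beta> a) @ b (replicate s a) # replicate q a)"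

  \<comment> \<open>Inner operation before \<open>c\<close>.\<close>
  have l_vanish: "?l t p s u = 0" if "m < p + s + u" for t p s u
    using that b_double_insertion_vanishes[OF a' ba' a b_power_filtered[OF ba'] c, of s p u t]
    by (cases "s = 0") (simp_all add: b_Nil lin_zero)
  have "(\<Sum>r\<le>m. \<Sum>t\<le>m. \<Sum>p\<le>r. \<Sum>s\<le>r - p. ?l t p s (r - p - s))
      = (\<Sum>t\<le>m. \<Sum>r\<le>m. \<Sum>p\<le>r. \<Sum>s\<le>r - p. ?l t p s (r - p - s))"
    by (rule sum.swap)
  also have "\<dots> = (\<Sum>t\<le>m. \<Sum>p\<le>m. \<Sum>s\<le>m. \<Sum>u\<le>m. ?l t p s u)"
    by (intro sum.cong refl sum_compositions_eq_cube l_vanish)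
  also have "\<dots> = (\<Sum>t\<le>m. \<Sum>p\<le>m. \<Sum>u\<le>m. \<Sum>s\<le>m. ?l t p s u)"
    by (intro sum.cong refl sum.swap)
  also have "\<dots> = (\<Sum>t\<le>m. \<Sum>p\<le>m. \<Sum>u\<le>m.
      b (replicate p a' @ curvature (\<beta> a') # replicate u (\<beta> a') @ c # replicate t a))"
    by (simp add: curvature_def lin_sum)
  also have "\<dots> = 0"
    by (simp add: curvature_bar multiadditive_minus[OF b_multiadditive]
        curvature_vanishes_in_product(1)[OF a' ba' a c bar_filtered[OF D']])
  finally have L: "(\<Sum>r\<le>m. \<Sum>t\<le>m. \<Sum>p\<le>r. \<Sum>s\<le>r - p. ?l t p s (r - p - s)) = 0" .

  \<comment> \<open>Inner operation after \<open>c\<close>.\<close>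
  have r_vanish: "?r r p s q = 0" if "m < p + s + q" for r p s q
    using that b_double_insertion_vanishes[OF a' ba a bc b_power_filtered[OF a], of s r p q]
      lin_zero[of "replicate r a' @ \<beta> c # replicate p (\<beta> a)" "replicate q a"]
    by (cases "s = 0") (simp_all add: b_Nil)
  have "(\<Sum>r\<le>m. \<Sum>t\<le>m. \<Sum>p\<le>t. \<Sum>s\<le>t - p. ?r r p s (t - p - s))
      = (\<Sum>r\<le>m. \<Sum>p\<le>m. \<Sum>s\<le>m. \<Sum>q\<le>m. ?r r p s q)"
    by (intro sum.cong refl sum_compositions_eq_cube r_vanish)
  also have "\<dots> = (\<Sum>r\<le>m. \<Sum>p\<le>m. \<Sum>q\<le>m. \<Sum>s\<le>m. ?r r p s q)"
    by (intro sum.cong refl sum.swap)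
  also have "\<dots> = (\<Sum>r\<le>m. \<Sum>p\<le>m. \<Sum>q\<le>m.
      b (replicate r a' @ \<beta> c # replicate p (\<beta> a) @ curvature a # replicate q a))"
    using lin_sum[of "replicate _ a' @ \<beta> c # replicate _ (\<beta> a)" _ "{..m}" "replicate _ a"]
    by (simp add: curvature_def)
  also have "\<dots> = 0"
    by (simp add: curvature_vanishes_in_product(2)[OF a' ba a bc D])
  finally have R: "(\<Sum>r\<le>m. \<Sum>t\<le>m. \<Sum>p\<le>t. \<Sum>s\<le>t - p. ?r r p s (t - p - s)) = 0" .

  \<comment> \<open>Inner operation around \<open>c\<close>.\<close>
  have w: "?w r t \<in> F (Suc (r + t))" for r t
    using b_filtered[of "replicate r (\<beta> a') @ c # replicate t a" "replicate r 1 @ 1 # replicate t 1"]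
      filtered_replicate[OF ba', of r] filtered_replicate[OF a, of t] c
    by (auto simp: sum_list_replicate intro!: list_all2_appendI)
  have m_vanish: "?m p r t q = 0" if "m < p + r + t + q" for p r t q
    using b_insertion_vanishes[OF a' a w, of p r t q] that by simp
  have "(\<Sum>r\<le>m. \<Sum>t\<le>m. \<Sum>p\<le>r. \<Sum>u\<le>t. ?m p (r - p) u (t - u))
      = (\<Sum>r\<le>m. \<Sum>p\<le>r. \<Sum>t\<le>m. \<Sum>u\<le>t. ?m p (r - p) u (t - u))"
    by (intro sum.cong refl sum.swap)
  also have "\<dots> = (\<Sum>r\<le>m. \<Sum>p\<le>r. \<Sum>u\<le>m. \<Sum>q\<le>m. ?m p (r - p) u q)"
    by (intro sum.cong refl sum_antidiagonals_eq_square m_vanish) simp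
  also have "\<dots> = (\<Sum>p\<le>m. \<Sum>r\<le>m. \<Sum>u\<le>m. \<Sum>q\<le>m. ?m p r u q)"
    by (intro sum_antidiagonals_eq_square sum.neutral ballI m_vanish) simp
  also have "\<dots> = (\<Sum>p\<le>m. \<Sum>q\<le>m. \<Sum>r\<le>m. \<Sum>u\<le>m. ?m p r u q)"
    by (subst sum.swap[of _ "{..m}" "{..m}"], subst (2) sum.swap, rule refl)
  also have "\<dots> = (\<Sum>p\<le>m. \<Sum>q\<le>m. b (replicate p a' @ homotopy a' c a # replicate q a))"
    by (simp add: homotopy_def lin_sum)
  finally have M: "(\<Sum>r\<le>m. \<Sum>t\<le>m. \<Sum>p\<le>r. \<Sum>u\<le>t. ?m p (r - p) u (t - u))
      = (\<Sum>p\<le>m. \<Sum>q\<le>m. b (replicate p a' @ homotopy a' c a # replicate q a))" .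

  have "(\<Sum>r\<le>m. \<Sum>t\<le>m. (\<Sum>p\<le>r. \<Sum>s\<le>r - p. ?l t p s (r - p - s))
      + (\<Sum>p\<le>r. \<Sum>u\<le>t. ?m p (r - p) u (t - u))
      + (\<Sum>p\<le>t. \<Sum>s\<le>t - p. ?r r p s (t - p - s))) = 0"
    by (simp only: relation_two_powers sum.neutral_const)
  then have "(\<Sum>p\<le>m. \<Sum>q\<le>m. b (replicate p a' @ homotopy a' c a # replicate q a)) = 0"
    unfolding sum.distrib L M R by simp
  then have "curvature a' - curvature a
      = (\<Sum>p\<le>m. \<Sum>q\<le>m. b (replicate p a' @ (a' - a - homotopy a' c a) # replicate q a))"
    unfolding multiadditive_diff[OF b_multiadditive, of _ "a' - a"] sum_subtractf telescope[OF a a']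
    by simp
  also have "\<dots> = b [a' - a - homotopy a' c a]"
    by (rule b_corner[OF a' a e])
  finally show ?thesis .
qed

end

section \<open>Matrices over an \<open>A\<^sub>\<infinity>\<close>-structure\<close>

text \<open>
  Unfolded, the entry \<open>(i, j)\<close> is the sum of \<open>f [M\<^sub>1 k\<^sub>0 k\<^sub>1, \<dots>, M\<^sub>n k\<^sub>n\<^sub>-\<^sub>1 k\<^sub>n]\<close> over all index paths from
  \<open>k\<^sub>0 = i\<close> to \<open>k\<^sub>n = j\<close>. The recursion \<open>path_sum_Cons\<close>, in which \<open>f\<close> varies, reduces identities
  for matrices to identities for the lists of entries along one path.
\<close>

abbreviation path_sum :: "nat \<Rightarrow> ('a::ab_group_add list \<Rightarrow> 'a) \<Rightarrow> 'a matrix list \<Rightarrow> 'a matrix" where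
  "path_sum m f Ms \<equiv> apply_entries f (odot_list m Ms)"

lemma sum_mset_sum_swap:
  fixes g :: "'k \<Rightarrow> 'x \<Rightarrow> 'a::comm_monoid_add"
  shows "(\<Sum>x\<in>#X. \<Sum>k\<in>K. g k x) = (\<Sum>k\<in>K. \<Sum>x\<in>#X. g k x)"
  by (induction X) (simp_all add: sum.distrib)

lemma sum_mset_tensor_mult:
  "(\<Sum>zs\<in>#tensor_mult X Y. f zs) = (\<Sum>xs\<in>#X. \<Sum>ys\<in>#Y. f (xs @ ys))"
  by (induction X) (simp_all add: tensor_mult_def image_mset.compositionality comp_def)

lemma sum_mset_sum_index:
  "finite K \<Longrightarrow> (\<Sum>x\<in>#(\<Sum>k\<in>K. X k). f x) = (\<Sum>k\<in>K. \<Sum>x\<in>#X k. f x)"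
  by (induction K rule: finite_induct) simp_all

lemma path_sum_Nil: "path_sum m f [] i j = (if i = j then f [] else 0)"
  by (simp add: apply_entries_def odot_list_def odot_unit_def)

lemma path_sum_Cons:
  "path_sum m f (M # Ms) i j = (\<Sum>k\<le>m. path_sum m (\<lambda>xs. f (M i k # xs)) Ms k j)"
  by (simp add: apply_entries_def odot_list_def odot_def sum_mset_tensor_mult sum_mset_sum_index)

lemma path_sum_add:
  "path_sum m (\<lambda>xs. f xs + g xs) Ms i j = path_sum m f Ms i j + path_sum m g Ms i j"
  by (simp add: apply_entries_def sum_mset.distrib)

lemma path_sum_minus: "path_sum m (\<lambda>xs. - f xs) Ms i j = - path_sum m f Ms i j"
  by (induction Ms arbitrary: f i) (simp_all add: path_sum_Nil path_sum_Cons sum_negf)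

lemma path_sum_sum:
  "path_sum m (\<lambda>xs. \<Sum>k\<in>K. g k xs) Ms i j = (\<Sum>k\<in>K. path_sum m (g k) Ms i j)"
  by (simp add: apply_entries_def sum_mset_sum_swap)

lemma path_sum_swap:
  "path_sum m (\<lambda>xs. path_sum m (f xs) Ns k l) Ms i j
    = path_sum m (\<lambda>ys. path_sum m (\<lambda>xs. f xs ys) Ms i j) Ns k l"
  unfolding apply_entries_def by (rule sum_mset.swap)

lemma path_sum_cong:
  "(\<And>xs. length xs = length Ms \<Longrightarrow> f xs = g xs) \<Longrightarrow> path_sum m f Ms i j = path_sum m g Ms i j"
proof (induction Ms arbitrary: f g i)
  case (Cons M Ms)
  then show ?case
    unfolding path_sum_Cons by (intro sum.cong refl Cons.IH) simp
qed (simp add: path_sum_Nil)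

lemma path_sum_map:
  "path_sum m f (map (\<lambda>M i j. \<beta> (M i j)) Ms) i j = path_sum m (\<lambda>xs. f (map \<beta> xs)) Ms i j"
  by (induction Ms arbitrary: f i) (simp_all add: path_sum_Nil path_sum_Cons)

text \<open>
Paths are cut at the index \<open>k\<close> between the two words.
\<close>

lemma path_sum_append:
  "i \<le> m \<Longrightarrow> path_sum m f (Ms @ Ns) i j
    = (\<Sum>k\<le>m. path_sum m (\<lambda>xs. path_sum m (\<lambda>ys. f (xs @ ys)) Ns k j) Ms i k)"
proof (induction Ms arbitrary: f i)
  case Nil
  then show ?case
    by (simp add: path_sum_Nil)
next
  case (Cons M Ms)
  have "path_sum m f ((M # Ms) @ Ns) i j = (\<Sum>l\<le>m. \<Sum>k\<le>m.
      path_sum m (\<lambda>xs. path_sum m (\<lambda>ys. f (M i l # xs @ ys)) Ns k j) Ms l k)"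
    by (simp add: path_sum_Cons Cons.IH)
  also have "\<dots> = (\<Sum>k\<le>m. \<Sum>l\<le>m.
      path_sum m (\<lambda>xs. path_sum m (\<lambda>ys. f (M i l # xs @ ys)) Ns k j) Ms l k)"
    by (rule sum.swap)
  finally show ?case
    by (simp add: path_sum_Cons)
qed

lemma multiadditive_Cons: "multiadditive f \<Longrightarrow> multiadditive (\<lambda>xs. f (x # xs))"
  by (simp add: multiadditive_def) (metis append_Cons)

lemma path_sum_multiadditive:
  "multiadditive f \<Longrightarrow> path_sum m f (Ms @ (X + Y) # Ns) i j
    = path_sum m f (Ms @ X # Ns) i j + path_sum m f (Ms @ Y # Ns) i j"
proof (induction Ms arbitrary: f i)
  case Nil
  then show ?case
    using multiadditiveD[of f "[]"] by (simp add: path_sum_Cons path_sum_add sum.distrib)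
next
  case (Cons M Ms)
  then show ?case
    by (simp add: path_sum_Cons multiadditive_Cons sum.distrib)
qed

definition matrix_filtration :: "nat \<Rightarrow> nat \<Rightarrow> 'a::zero matrix set" where
  "matrix_filtration m k = {M. \<forall>i j. M i j \<noteq> 0 \<longrightarrow> i + k \<le> j \<and> j \<le> m}"

lemma matrix_filtrationD: "M \<in> matrix_filtration m k \<Longrightarrow> M i j \<noteq> 0 \<Longrightarrow> i + k \<le> j \<and> j \<le> m"
  by (simp add: matrix_filtration_def)

lemma corner_filtrationI:
  assumes "\<And>i j. M i j \<noteq> 0 \<Longrightarrow> i = 0 \<and> j = m"
  shows "M \<in> matrix_filtration m m"
  unfolding matrix_filtration_def using assms by simp

lemma Mat_plus_eq_filtration: "Mat_plus m = matrix_filtration m 1"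
  unfolding Mat_plus_def matrix_filtration_def by (auto simp: Suc_le_eq)

lemma path_sum_filtered:
  assumes "list_all2 (\<lambda>M k. M \<in> matrix_filtration m k) Ms ks" "multiadditive f" "\<not> i + sum_list ks \<le> j"
  shows "path_sum m f Ms i j = 0"
  using assms
proof (induction Ms ks arbitrary: f i rule: list_all2_induct)
  case Nil
  then show ?case by (simp add: path_sum_Nil)
next
  case (Cons M Ms d ks)
  have "path_sum m (\<lambda>xs. f (M i k # xs)) Ms k j = 0" for k
  proof (cases "M i k = 0")
    case True
    then have "f (M i k # xs) = 0" for xs
      using multiadditive_zero[OF Cons.prems(1), of "[]"] by simp
    then show ?thesis
      by (simp add: apply_entries_def)
  next
    case False
    then have "i + d \<le> k" using Cons.hyps by (simp add: matrix_filtration_def)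
    then show ?thesis
      using Cons.prems by (intro Cons.IH multiadditive_Cons) auto
  qed
  then show ?case by (simp add: path_sum_Cons)
qed

text \<open>
  The index range of matrices is that of all natural numbers, whereas inner indices of a product
  stop at \<open>m\<close>. Entries outside the range are set to 0, so that the relation holds for matrices
  without restrictions on their support.
\<close>

definition matrix_op :: "nat \<Rightarrow> ('a::ab_group_add list \<Rightarrow> 'a) \<Rightarrow> 'a matrix list \<Rightarrow> 'a matrix" where
  "matrix_op m b Ms = (\<lambda>i j. if i \<le> m \<and> j \<le> m then path_sum m b Ms i j else 0)"

lemma sum_matrix_entry: "(\<Sum>k\<in>K. (M k :: 'a::ab_group_add matrix)) i j = (\<Sum>k\<in>K. M k i j)"
  by (induction K rule: infinite_finite_induct) simp_all

context involutive_A_infinity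
begin

abbreviation matrix_bar :: "'a matrix \<Rightarrow> 'a matrix" where
  "matrix_bar M \<equiv> (\<lambda>i j. \<beta> (M i j))"

text \<open>
  Cutting each path at the two ends of the inner block separates the sum over the inner part of the
  path, which is the entry of the inner matrix because \<open>b\<close> is additive in each argument.
\<close>

lemma matrix_insertion:
  assumes "r \<le> length Ms" "s \<le> length Ms - r" "i \<le> m" "j \<le> m"
  shows "insertion (matrix_op m b) matrix_bar r s Ms i j = path_sum m (insertion b \<beta> r s) Ms i j"
proof -
  \<comment> \<open>The word is cut into the letters before, inside and after the inner block.\<close>
  define U S T where "U = take r Ms" "S = take s (drop r Ms)" "T = drop (r + s) Ms"
  have Ms: "Ms = U @ S @ T"
    unfolding U_S_T_def by (metis append_take_drop_id drop_drop add.commute)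
  have len: "length U = r" "length S = s"
    using assms by (simp_all add: U_S_T_def)
  let ?X = "matrix_op m b S"
  have "insertion (matrix_op m b) matrix_bar r s Ms i j
      = path_sum m b (map matrix_bar U @ ?X # T) i j"
    using assms by (simp add: insertion_def matrix_op_def U_S_T_def)
  also have "\<dots> = (\<Sum>k\<le>m. path_sum m (\<lambda>us. \<Sum>l\<le>m.
      path_sum m (\<lambda>ts. b (map \<beta> us @ ?X k l # ts)) T l j) U i k)"
    using assms by (simp add: path_sum_append path_sum_map path_sum_Cons)
  also have "\<dots> = (\<Sum>k\<le>m. path_sum m (\<lambda>us. \<Sum>l\<le>m.
      path_sum m (\<lambda>ts. path_sum m (\<lambda>vs. b (map \<beta> us @ b vs # ts)) S k l) T l j) U i k)"
  proof (intro sum.cong refl path_sum_cong)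
    fix k l us ts assume "k \<in> {..m}" "l \<in> {..m}"
    then have "?X k l = (\<Sum>vs\<in>#odot_list m S k l. b vs)"
      by (simp add: matrix_op_def apply_entries_def)
    then show "b (map \<beta> us @ ?X k l # ts) = path_sum m (\<lambda>vs. b (map \<beta> us @ b vs # ts)) S k l"
      by (simp add: apply_entries_def multiadditive_sum_mset[OF b_multiadditive])
  qed
  also have "\<dots> = (\<Sum>k\<le>m. path_sum m (\<lambda>us. \<Sum>l\<le>m.
      path_sum m (\<lambda>vs. path_sum m (\<lambda>ts. b (map \<beta> us @ b vs # ts)) T l j) S k l) U i k)"
    by (subst path_sum_swap) (rule refl)
  also have "\<dots> = (\<Sum>k\<le>m. path_sum m (\<lambda>us. \<Sum>l\<le>m.
      path_sum m (\<lambda>vs. path_sum m (\<lambda>ts. insertion b \<beta> r s (us @ vs @ ts)) T l j) S k l) U i k)"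
    by (intro sum.cong refl path_sum_cong) (simp add: insertion_def len)
  also have "\<dots> = (\<Sum>k\<le>m. path_sum m (\<lambda>us.
      path_sum m (\<lambda>ws. insertion b \<beta> r s (us @ ws)) (S @ T) k j) U i k)"
    by (intro sum.cong refl path_sum_cong) (simp add: path_sum_append)
  also have "\<dots> = path_sum m (insertion b \<beta> r s) Ms i j"
    unfolding Ms by (rule path_sum_append[OF \<open>i \<le> m\<close>, symmetric])
  finally show ?thesis .
qed

text \<open>
  Each axiom holds for matrices because it holds for the list of entries along every path; for the
  relation this is \<open>matrix_insertion\<close>.
\<close>

lemma involutive_A_infinity_matrix: "involutive_A_infinity (matrix_op m b) matrix_bar"
proof
  show "matrix_op m b [] = 0"
    by (intro ext) (simp add: matrix_op_def path_sum_Nil b_Nil)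
  show "multiadditive (matrix_op m b)"
    unfolding multiadditive_def matrix_op_def
    by (auto simp: fun_eq_iff path_sum_multiadditive[OF b_multiadditive])
  show "matrix_bar (matrix_bar M) = M" for M
    by (simp add: bar_bar)
  show "matrix_bar (M + M') = matrix_bar M + matrix_bar M'" for M M'
    by (auto simp: fun_eq_iff bar_add)
  show "matrix_bar (matrix_op m b Ms) = - matrix_op m b (map matrix_bar Ms)" for Ms
  proof (intro ext)
    fix i j
    have "\<beta> (path_sum m b Ms i j) = path_sum m (\<lambda>xs. \<beta> (b xs)) Ms i j"
      by (simp add: apply_entries_def bar_sum_mset)
    then show "matrix_bar (matrix_op m b Ms) i j = (- matrix_op m b (map matrix_bar Ms)) i j"
      by (simp add: matrix_op_def path_sum_map bar_b path_sum_minus bar_zero)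
  qed
  show "(\<Sum>r\<le>length Ms. \<Sum>s\<le>length Ms - r. insertion (matrix_op m b) matrix_bar r s Ms) = 0" for Ms
  proof (intro ext)
    fix i j
    have "(\<Sum>r\<le>length Ms. \<Sum>s\<le>length Ms - r. insertion (matrix_op m b) matrix_bar r s Ms i j) = 0"
    proof (cases "i \<le> m \<and> j \<le> m")
      case True
      then have "(\<Sum>r\<le>length Ms. \<Sum>s\<le>length Ms - r. insertion (matrix_op m b) matrix_bar r s Ms i j)
          = path_sum m (\<lambda>xs. \<Sum>r\<le>length Ms. \<Sum>s\<le>length Ms - r. insertion b \<beta> r s xs) Ms i j"
        by (simp add: path_sum_sum matrix_insertion)
      also have "\<dots> = path_sum m (\<lambda>xs. 0) Ms i j"
        by (rule path_sum_cong) (metis relation)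
      finally show ?thesis
        by (simp add: apply_entries_def)
    qed (auto simp: insertion_def matrix_op_def)
    then show "(\<Sum>r\<le>length Ms. \<Sum>s\<le>length Ms - r. insertion (matrix_op m b) matrix_bar r s Ms) i j
        = (0 :: 'a matrix) i j"
      by (simp add: sum_matrix_entry)
  qed
qed

lemma filtered_A_infinity_matrix:
  "filtered_A_infinity (matrix_op m b) matrix_bar (matrix_filtration m) m"
proof -
  interpret M: involutive_A_infinity "matrix_op m b" matrix_bar
    by (rule involutive_A_infinity_matrix)
  show ?thesis
  proof
    show "matrix_op m b Ms \<in> matrix_filtration m (sum_list ks)"
      if "list_all2 (\<lambda>M k. M \<in> matrix_filtration m k) Ms ks" for Ms ks
      using path_sum_filtered[OF that b_multiadditive]
      by (auto simp: matrix_filtration_def[of m "sum_list ks"] matrix_op_def)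
    show "matrix_bar M \<in> matrix_filtration m k" if "M \<in> matrix_filtration m k" for M k
      using that bar_zero unfolding matrix_filtration_def by (simp; metis)
    show "M = 0" if "m < k" "M \<in> matrix_filtration m k" for M :: "'a matrix" and k
      using that by (fastforce simp: matrix_filtration_def fun_eq_iff)
  qed
qed

end

section \<open>Signs in graded vector spaces\<close>

lemma signed_add: "signed d (x + y) = signed d x + signed d y"
  by (simp add: signed_def)

lemma signed_zero: "signed d 0 = 0"
  by (simp add: signed_def)

lemma signed_signed: "signed d (signed e x) = signed (d + e) x"
  by (simp add: signed_def)

context graded_vector_space
begin

abbreviation component :: "'a \<Rightarrow> int \<Rightarrow> 'a" where
  "component x \<equiv> (THE c. is_decomposition N V x c)"

lemma component_decomposition: "is_decomposition N V x (component x)"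
  by (rule theI'[OF direct_sum])

lemma component_eqI: "is_decomposition N V x c \<Longrightarrow> component x = c"
  using direct_sum by (rule the1_equality)

lemma component_add: "component (x + y) = (\<lambda>d. component x d + component y d)"
proof (rule component_eqI)
  let ?c = "component x" and ?e = "component y"
  have c: "is_decomposition N V x ?c" and e: "is_decomposition N V y ?e"
    by (rule component_decomposition)+
  have fin: "finite {d. ?c d \<noteq> 0}" "finite {d. ?e d \<noteq> 0}"
    using c e by (simp_all add: is_decomposition_def)
  have "{d. ?c d + ?e d \<noteq> 0} \<subseteq> {d. ?c d \<noteq> 0} \<union> {d. ?e d \<noteq> 0}" by auto
  moreover have "x + y = Sum_any (\<lambda>d. ?c d + ?e d)"
    using c e Sum_any.distrib[OF fin] by (simp add: is_decomposition_def)
  ultimately show "is_decomposition N V (x + y) (\<lambda>d. ?c d + ?e d)"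
    using c e fin subspace_add[OF subspace_V] finite_subset[of "{d. ?c d + ?e d \<noteq> 0}"]
    by (auto simp: is_decomposition_def)
qed

lemma component_homogeneous:
  assumes "d \<in> degrees N" "x \<in> V d"
  shows "component x = (\<lambda>e. if e = d then x else 0)"
proof (rule component_eqI)
  have "finite {e. (if e = d then x else 0) \<noteq> 0}"
    by (rule finite_subset[of _ "{d}"]) auto
  then show "is_decomposition N V x (\<lambda>e. if e = d then x else 0)"
    using assms subspace_0[OF subspace_V] by (auto simp: is_decomposition_def)
qed

lemma homogeneous_induct [case_names zero add homogeneous]:
  assumes zero: "P 0" and add: "\<And>x y. P x \<Longrightarrow> P y \<Longrightarrow> P (x + y)"
    and homogeneous: "\<And>d x. d \<in> degrees N \<Longrightarrow> x \<in> V d \<Longrightarrow> P x"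
  shows "P x"
proof -
  let ?c = "component x"
  have c: "is_decomposition N V x ?c"
    by (rule component_decomposition)
  have "P (\<Sum>d\<in>D. ?c d)" for D
  proof (induction D rule: infinite_finite_induct)
    case (insert d D)
    have "P (?c d)"
      using c zero homogeneous[of d "?c d"] by (cases "d \<in> degrees N") (auto simp: is_decomposition_def)
    then show ?case
      using insert by (simp add: add)
  qed (simp_all add: zero)
  then show ?thesis
    using c by (metis (no_types) Sum_any.expand_set is_decomposition_def)
qed

lemma bar_homogeneous: "d \<in> degrees N \<Longrightarrow> x \<in> V d \<Longrightarrow> bar N V x = signed d x"
  by (simp add: bar_def component_homogeneous if_distrib[of "signed _"] signed_zero
      cong: if_cong)

lemma bar_add: "bar N V (x + y) = bar N V x + bar N V y"
proof -
  have fin: "finite {d. signed d (component z d) \<noteq> 0}" for z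
    using component_decomposition[of z]
    by (auto simp: is_decomposition_def signed_def elim!: rev_finite_subset)
  show ?thesis
    unfolding bar_def component_add signed_add by (rule Sum_any.distrib[OF fin fin])
qed

lemma bar_zero: "bar N V 0 = 0"
  using bar_add[of 0 0] by simp

lemma signed_in_V: "d \<in> degrees N \<Longrightarrow> x \<in> V d \<Longrightarrow> signed e x \<in> V d"
  using subspace_neg[OF subspace_V] by (simp add: signed_def)

lemma bar_bar: "bar N V (bar N V x) = x"
proof (induction x rule: homogeneous_induct)
  case (homogeneous d x)
  then show ?case
    by (simp add: bar_homogeneous signed_in_V) (simp add: signed_def)
qed (simp_all add: bar_zero bar_add)

text \<open>
  Identities that are additive in each argument need only be checked on homogeneous arguments. The
  arguments are made homogeneous one by one, from the left.
\<close>

lemma multiadditive_eq_zeroI: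
  assumes f: "multiadditive f"
    and homogeneous: "\<And>ds xs. homogeneous_list N V ds xs \<Longrightarrow> f xs = 0"
  shows "f xs = 0"
proof -
  have "f (us @ xs) = 0" if "homogeneous_list N V ds us" for us ds
    using that
  proof (induction xs arbitrary: us ds)
    case Nil
    then show ?case by (simp add: homogeneous)
  next
    case (Cons x xs)
    show ?case
    proof (induction x rule: homogeneous_induct)
      case zero
      show ?case by (rule multiadditive_zero[OF f])
    next
      case (add x y)
      then show ?case by (simp add: multiadditiveD[OF f])
    next
      case (homogeneous d x)
      then have "homogeneous_list N V (ds @ [d]) (us @ [x])"
        using Cons.prems by (auto simp: homogeneous_list_def intro: list_all2_appendI)
      from Cons.IH[OF this] show ?case by simp
    qed
  qed
  from this[of "[]" "[]"] show ?thesis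
    by (simp add: homogeneous_list_def)
qed

end

text \<open>
  The varying letter lies before, inside or after the inner block, and in each case \<open>insertion\<close> is
  a composite of functions that are additive in it.
\<close>

lemma multiadditive_insertion:
  assumes b: "multiadditive b" and add: "\<And>x y. \<beta> (x + y) = \<beta> x + \<beta> y"
  shows "multiadditive (insertion b \<beta> r s)"
proof -
  have "insertion b \<beta> r s (us @ (x + y) # vs)
      = insertion b \<beta> r s (us @ x # vs) + insertion b \<beta> r s (us @ y # vs)" for us x y vs
  proof -
    have split: "insertion b \<beta> r s (us @ z # vs) =
        (if length us < r then
          b (map \<beta> us @ \<beta> z # map \<beta> (take (r - Suc (length us)) vs) @
            b (take s (drop (r - Suc (length us)) vs)) # drop (r + s - Suc (length us)) vs)
         else if length us < r + s then
          b (map \<beta> (take r us) @ b (drop r us @ z # take (r + s - Suc (length us)) vs)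
            # drop (r + s - Suc (length us)) vs)
         else b ((map \<beta> (take r us) @ b (take s (drop r us)) # drop (r + s) us) @ z # vs))" for z
    proof (cases "length us < r")
      case True
      then obtain k where "r = Suc (length us + k)"
        using less_imp_Suc_add by blast
      then show ?thesis by (simp add: insertion_def)
    next
      case False
      show ?thesis
      proof (cases "length us < r + s")
        case True
        then obtain k where k: "r + s = Suc (length us + k)"
          using less_imp_Suc_add by blast
        then have "s - (length us - r) = Suc k" using False by simp
        then show ?thesis using False True k by (simp add: insertion_def)
      qed (use False in \<open>simp add: insertion_def\<close>)
    qed
    show ?thesis
      unfolding split using multiadditiveD[OF b] 
          multiadditiveD[OF b, of "map \<beta> (take r us) @ b (take s (drop r us)) # drop (r + s) us"]
          multiadditiveD[OF b, of "map \<beta> us @ \<beta> _ # _"]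
      by (simp add: add)
  qed
  then show ?thesis
    by (simp add: multiadditive_def)
qed

context A_infinity_algebra
begin

text \<open>The operations \<open>b\<^sub>n\<close> for \<open>n \<ge> 1\<close>, with the arbitrary value \<open>b []\<close> replaced by \<open>b\<^sub>0 = 0\<close>.\<close>

definition b0 :: "'a list \<Rightarrow> 'a" where
  "b0 xs = (if xs = [] then 0 else b xs)"

lemma b0_multiadditive: "multiadditive b0"
  unfolding multiadditive_def b0_def
  using multilinear by (simp add: Vector_Spaces.linear_iff)

lemma b0_bar:
  assumes "homogeneous_list N V ds xs"
  shows "b0 (us @ map (bar N V) xs @ ys) = signed (sum_list ds) (b0 (us @ xs @ ys))"
  using assms unfolding homogeneous_list_def
proof (induction ds xs arbitrary: us rule: list_all2_induct)
  case Nil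
  then show ?case by (simp add: signed_def)
next
  case (Cons d ds x xs)
  have "bar N V x = signed d x"
    using Cons.hyps by (simp add: bar_homogeneous)
  with Cons.IH[of "us @ [bar N V x]"] show ?case
    by (simp add: multiadditive_signed[OF b0_multiadditive] signed_signed add.commute)
qed

text \<open>
  On homogeneous arguments both sides are multiples of \<open>b0 xs\<close> by signs that differ because \<open>b\<close>
  raises the degree by 1; as \<open>N\<close> is even, reducing degrees modulo \<open>N\<close> keeps their parity.
\<close>

lemma bar_b0: "bar N V (b0 xs) = - b0 (map (bar N V) xs)"
proof -
  have "bar N V (b0 xs) + b0 (map (bar N V) xs) = 0"
  proof (rule multiadditive_eq_zeroI[where f = "\<lambda>xs. bar N V (b0 xs) + b0 (map (bar N V) xs)"])
    show "multiadditive (\<lambda>xs. bar N V (b0 xs) + b0 (map (bar N V) xs))"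
      by (simp add: multiadditive_def multiadditiveD[OF b0_multiadditive] bar_add)
  next
    fix ds xs assume h: "homogeneous_list N V ds xs"
    show "bar N V (b0 xs) + b0 (map (bar N V) xs) = 0"
    proof (cases "xs = []")
      case False
      have deg: "(sum_list ds + 1) mod N \<in> degrees N"
        using period by (auto simp: degrees_def)
      have parity: "even ((sum_list ds + 1) mod N) \<longleftrightarrow> odd (sum_list ds)"
        using period by (auto simp: even_even_mod_4_iff dvd_mod_iff)
      have "bar N V (b xs) = signed ((sum_list ds + 1) mod N) (b xs)"
        by (rule bar_homogeneous[OF deg degree_one[OF False h]])
      then show ?thesis
        using b0_bar[OF h, of "[]" "[]"] False parity by (simp add: b0_def signed_def)
    qed (simp add: b0_def bar_zero)
  qed
  then show ?thesis by (simp add: eq_neg_iff_add_eq_0)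
qed

lemma b0_relation_homogeneous:
  assumes h: "homogeneous_list N V ds xs" and ne: "xs \<noteq> []"
  shows "(\<Sum>r\<le>length xs. \<Sum>s\<le>length xs - r. insertion b0 (bar N V) r s xs) = 0"
proof -
  let ?n = "length xs"
  have term_eq: "insertion b0 (bar N V) r s xs = signed (sum_list (take r ds))
      (b (take r xs @ [b (take s (drop r xs))] @ drop (r + s) xs))"
    if "r + s \<le> ?n" "1 \<le> s" for r s
  proof -
    have "homogeneous_list N V (take r ds) (take r xs)"
      using h by (simp add: homogeneous_list_def)
    from b0_bar[OF this, of "[]" "b0 (take s (drop r xs)) # drop (r + s) xs"] show ?thesis
      using that ne by (auto simp: insertion_def b0_def)
  qed
  have "(\<Sum>r\<le>?n. \<Sum>s\<le>?n - r. insertion b0 (bar N V) r s xs)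
      = (\<Sum>(r, s)\<in>Sigma {..?n} (\<lambda>r. {..?n - r}). insertion b0 (bar N V) r s xs)"
    by (simp add: sum.Sigma)
  also have "\<dots> = (\<Sum>(r, s)\<in>Sigma {..?n} (\<lambda>r. {1..?n - r}). insertion b0 (bar N V) r s xs)"
  proof (rule sum.mono_neutral_right)
    have zero: "insertion b0 (bar N V) r 0 xs = 0" for r
      by (simp add: insertion_def b0_def[of "[]"] multiadditive_zero[OF b0_multiadditive])
    show "\<forall>x\<in>Sigma {..?n} (\<lambda>r. {..?n - r}) - Sigma {..?n} (\<lambda>r. {1..?n - r}).
        (case x of (r, s) \<Rightarrow> insertion b0 (bar N V) r s xs) = 0"
    proof
      fix x assume "x \<in> Sigma {..?n} (\<lambda>r. {..?n - r}) - Sigma {..?n} (\<lambda>r. {1..?n - r})"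
      then have "snd x = 0" by (cases x) (auto simp: Suc_le_eq)
      then show "(case x of (r, s) \<Rightarrow> insertion b0 (bar N V) r s xs) = 0"
        using zero by (cases x) simp
    qed
  qed auto
  also have "\<dots> = (\<Sum>(r, s, t) | r + s + t = ?n \<and> 1 \<le> s. signed (sum_list (take r ds))
      (b (take r xs @ [b (take s (drop r xs))] @ drop (r + s) xs)))"
    by (rule sum.reindex_bij_witness[where j = "\<lambda>(r, s). (r, s, ?n - r - s)" and i = "\<lambda>(r, s, t). (r, s)"])
       (auto simp: term_eq)
  also have "\<dots> = 0"
    by (rule A_infinity[OF ne h])
  finally show ?thesis .
qed

lemma b0_relation: "(\<Sum>r\<le>length xs. \<Sum>s\<le>length xs - r. insertion b0 (bar N V) r s xs) = 0"
proof (rule multiadditive_eq_zeroI[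
    where f = "\<lambda>xs. \<Sum>r\<le>length xs. \<Sum>s\<le>length xs - r. insertion b0 (bar N V) r s xs"])
  show "multiadditive (\<lambda>xs. \<Sum>r\<le>length xs. \<Sum>s\<le>length xs - r. insertion b0 (bar N V) r s xs)"
    using multiadditiveD[OF multiadditive_insertion[OF b0_multiadditive bar_add]]
    by (simp add: multiadditive_def sum.distrib)
next
  fix ds xs assume h: "homogeneous_list N V ds xs"
  show "(\<Sum>r\<le>length xs. \<Sum>s\<le>length xs - r. insertion b0 (bar N V) r s xs) = 0"
  proof (cases "xs = []")
    case True
    then show ?thesis
      using multiadditive_zero[OF b0_multiadditive, of "[]" "[]"] by (simp add: insertion_def b0_def[of "[]"])
  qed (rule b0_relation_homogeneous[OF h])
qed

lemma involutive_A_infinity_b0: "involutive_A_infinity b0 (bar N V)"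
  by unfold_locales
    (simp_all add: b0_def[of "[]"] b0_multiadditive bar_bar bar_add bar_b0 b0_relation)

end

section \<open>Equivalent defining systems\<close>

context A_infinity_algebra
begin

lemma b_single_add: "b [x + y] = b [x] + b [y]"
  using multiadditiveD[OF b0_multiadditive, of "[]" x y "[]"] by (simp add: b0_def)

lemma equiv_cohomologous: "equiv (cocycles b) (cohomologous b)"
proof (rule equivI)
  have zero: "b [0] = 0" using b_single_add[of 0 0] by simp
  have minus: "b [- x] = - b [x]" for x
    using b_single_add[of x "- x"] zero by (simp add: eq_neg_iff_add_eq_0 add.commute)
  show "cohomologous b \<subseteq> cocycles b \<times> cocycles b"
    by (auto simp: cohomologous_def)
  show "refl_on (cocycles b) (cohomologous b)"
    using zero by (auto simp: refl_on_def cohomologous_def coboundaries_def intro: rangeI[of _ 0] image_eqI[of _ _ 0])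
  show "sym (cohomologous b)"
  proof (rule symI)
    fix x y assume "(x, y) \<in> cohomologous b"
    moreover from this obtain z where "y - x = b [z]"
      by (auto simp: cohomologous_def coboundaries_def)
    then have "x - y = b [- z]" by (simp add: minus algebra_simps)
    ultimately show "(y, x) \<in> cohomologous b"
      by (auto simp: cohomologous_def coboundaries_def)
  qed
  show "trans (cohomologous b)"
  proof (rule transI)
    fix x y z assume xy: "(x, y) \<in> cohomologous b" and yz: "(y, z) \<in> cohomologous b"
    then obtain u v where "y - x = b [u]" "z - y = b [v]"
      by (auto simp: cohomologous_def coboundaries_def)
    then have "z - x = b [u + v]" by (simp add: b_single_add algebra_simps)
    then show "(x, z) \<in> cohomologous b"
      using xy yz by (auto simp: cohomologous_def coboundaries_def)
  qed
qed

lemma matrix_op_b0: "Ms \<noteq> [] \<Longrightarrow> i \<le> m \<Longrightarrow> j \<le> m \<Longrightarrow> matrix_op m b0 Ms i j = path_sum m b Ms i j"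
  by (auto simp: matrix_op_def b0_def intro!: path_sum_cong)

end

theorem theorem4p14:
  fixes scale :: "'k::field \<Rightarrow> 'a::ab_group_add \<Rightarrow> 'a"
    and N :: int
    and V :: "int \<Rightarrow> 'a set"
    and b :: "'a list \<Rightarrow> 'a"
    and m :: nat
    and \<alpha> :: "nat \<Rightarrow> 'a set"
    and a a' :: "'a matrix"
  assumes "A_infinity_algebra scale N V b"
    and "m \<ge> 2"
    and "\<forall>i\<in>{1..m}. \<alpha> i \<in> cohomology b"
    and "defining_system m b \<alpha> a"
    and "defining_system m b \<alpha> a'"
    and "equivalent_systems m b N V a a'"
  shows "cohomology_class b (massey_cocycle m b a') = cohomology_class b (massey_cocycle m b a)
    \<and> cohomology_class b (massey_cocycle m b a) \<in> cohomology b"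
proof -
  interpret A: A_infinity_algebra scale N V b by fact
  interpret I: involutive_A_infinity A.b0 "bar N V" by (rule A.involutive_A_infinity_b0)
  interpret M: filtered_A_infinity "matrix_op m A.b0" I.matrix_bar "matrix_filtration m" m
    by (rule I.filtered_A_infinity_matrix)

  have entry: "deformed_del m b x i j = M.curvature x i j"
    if x: "x \<in> matrix_filtration m 1" and ij: "i \<le> m" "j \<le> m" for x i j
  proof -
    let ?g = "\<lambda>n. matrix_op m A.b0 (replicate n x) i j"
    have "deformed_del m b x i j = Sum_any ?g"
      unfolding deformed_del_def
      by (intro arg_cong[of _ _ Sum_any] ext)
         (auto simp: A.matrix_op_b0[OF _ ij] M.b_Nil not_less_eq_eq)
    also have "\<dots> = (\<Sum>n\<le>m. ?g n)"
      using M.b_powers_vanish[OF x] by (intro Sum_any.expand_superset) (auto simp: not_le[symmetric], force)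
    finally show ?thesis
      by (simp add: M.curvature_def sum_matrix_entry)
  qed
  have corner: "M.curvature x \<in> matrix_filtration m m" if "defining_system m b \<alpha> x" for x
  proof -
    have x: "x \<in> matrix_filtration m 1" and z: "matrix_approx m (deformed_del m b x) (\<lambda>i j. 0)"
      using that by (auto simp: defining_system_def Mat_plus_eq_filtration)
    have "i = 0 \<and> j = m" if "M.curvature x i j \<noteq> 0" for i j
    proof -
      have "M.curvature x i j = 0" if "\<not> (i \<le> m \<and> j \<le> m)"
        using that by (auto simp: M.curvature_def sum_matrix_entry matrix_op_def)
      then have "i \<le> m" "j \<le> m"
        using that by blast+
      then show ?thesis
        using z that entry[OF x] by (auto simp: matrix_approx_def)
    qed
    then show ?thesis by (rule corner_filtrationI)
  qed
  have a: "a \<in> matrix_filtration m 1" and a': "a' \<in> matrix_filtration m 1"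
    using assms by (simp_all add: defining_system_def Mat_plus_eq_filtration)
  note D = corner[OF assms(4)] and D' = corner[OF assms(5)]
  obtain c where c: "c \<in> matrix_filtration m 1" and eq: "matrix_approx m (\<lambda>i j. a' i j - a i j)
      (\<lambda>i j. Sum_any (\<lambda>(r, t). path_sum m b
        (replicate r (I.matrix_bar a') @ [c] @ replicate t a) i j))"
    using assms(6) by (auto simp: equivalent_systems_def Mat_plus_eq_filtration)
  have homotopy_entry: "Sum_any (\<lambda>(r, t). path_sum m b
      (replicate r (I.matrix_bar a') @ [c] @ replicate t a) i j) = M.homotopy a' c a i j"
    if ij: "i \<le> m" "j \<le> m" for i j
  proof -
    let ?g = "\<lambda>(r, t). matrix_op m A.b0 (replicate r (I.matrix_bar a') @ c # replicate t a) i j"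
    have "Sum_any (\<lambda>(r, t). path_sum m b (replicate r (I.matrix_bar a') @ [c] @ replicate t a) i j)
        = Sum_any ?g"
      by (intro arg_cong[of _ _ Sum_any] ext) (auto simp: A.matrix_op_b0[OF _ ij])
    also have "\<dots> = (\<Sum>rt\<in>{..m} \<times> {..m}. ?g rt)"
    proof (rule Sum_any.expand_superset)
      have "?g (r, t) = 0" if "\<not> (r \<le> m \<and> t \<le> m)" for r t
        using M.b_insertion_vanishes[OF M.bar_filtered[OF a'] a c, of r t] that by auto
      then show "{rt. ?g rt \<noteq> 0} \<subseteq> {..m} \<times> {..m}" by auto
    qed simp
    finally show ?thesis
      by (simp add: M.homotopy_def sum_matrix_entry sum.cartesian_product[symmetric])
  qed
  \<comment> \<open>Equivalence only holds up to the corner entry; \<open>?e\<close> is the discrepancy there.\<close>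
  let ?e = "a' - a - M.homotopy a' c a"
  have e: "?e \<in> matrix_filtration m m"
  proof -
    have "i = 0 \<and> j = m" if "?e i j \<noteq> 0" for i j
    proof -
      have "i \<le> m \<and> j \<le> m"
      proof (rule ccontr)
        assume "\<not> (i \<le> m \<and> j \<le> m)"
        moreover from this have "a i j = 0" "a' i j = 0"
          using matrix_filtrationD[OF a, of i j] matrix_filtrationD[OF a', of i j] by linarith+
        ultimately show False
          using that by (auto simp: M.homotopy_def sum_matrix_entry matrix_op_def)
      qed
      then show ?thesis
        using eq that homotopy_entry by (auto simp: matrix_approx_def)
    qed
    then show ?thesis by (rule corner_filtrationI)
  qed
  have single: "matrix_op m A.b0 [x] 0 m = b [x 0 m]" for x
    by (simp add: matrix_op_def path_sum_Cons path_sum_Nil A.b0_def if_distrib cong: if_cong)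
  have cocycle: "massey_cocycle m b x \<in> cocycles b" if "defining_system m b \<alpha> x" for x
  proof -
    have x: "x \<in> matrix_filtration m 1"
      using that by (simp add: defining_system_def Mat_plus_eq_filtration)
    show ?thesis
      using M.curvature_closed[OF x corner[OF that]] single[of "M.curvature x"] entry[OF x, of 0 m]
      by (simp add: cocycles_def massey_cocycle_def)
  qed
  have "massey_cocycle m b a' - massey_cocycle m b a = b [?e 0 m]"
    using arg_cong[OF M.curvature_difference[OF a a' c D D' e], of "\<lambda>M. M 0 m"]
    unfolding single massey_cocycle_def by (simp add: entry[OF a] entry[OF a'])
  then have "(massey_cocycle m b a, massey_cocycle m b a') \<in> cohomologous b"
    using cocycle assms(4,5) by (auto simp: cohomologous_def coboundaries_def)
  then have "cohomology_class b (massey_cocycle m b a') = cohomology_class b (massey_cocycle m b a)"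
    unfolding cohomology_class_def by (rule equiv_class_eq[OF A.equiv_cohomologous, symmetric])
  moreover have "cohomology_class b (massey_cocycle m b a) \<in> cohomology b"
    unfolding cohomology_class_def cohomology_def by (rule quotientI[OF cocycle[OF assms(4)]])
  ultimately show ?thesis ..
qed

end
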